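(* Let $\sigma_v,\sigma_w,\sigma_a,\sigma_b>0$, $p^{(0)}\ge0$, and let $p^{(l)}$ be the length quantity of a full residual network (FRN) with nonlinearity $\phi=\psi_\alpha$. (1) If $\alpha=1$, then $p^{(l)}=\Theta\big((1+\sigma_v^2\sigma_w^2/2)^l\big)$ as $l\to\infty$, with the hidden constants depending on the initial condition. (2) If $0<\alpha<1$, then $p^{(l)}=\Theta(l^{\frac1{1-\alpha}})$; more precisely, $$\lim_{l\to\infty}\frac{p^{(l)}}{l^{\frac1{1-\alpha}}}=\big[\sigma_v^2\,\sigma_w^{2\alpha}\,\mathsf c_\alpha\,(1-\alpha)\big]^{\frac1{1-\alpha}}.$$
   Context: The $\alpha$-ReLU is $\psi_\alpha(x)=x^\alpha$ for $x>0$ and $\psi_\alpha(x)=0$ otherwise. Put $\mathrm V\phi(q)=\mathbb E[\phi(z)^2]$, $z\sim\mathcal N(0,q)$, and $\mathsf c_\alpha=\frac1{\sqrt\pi}2^{\alpha-1}\Gamma(\alpha+\frac12)$ (so that $\mathrm V\psi_\alpha(q)=\mathsf c_\alpha q^\alpha$ for $\alpha>-\frac12$). An FRN has layers $x^{(l)}_i=\sum_jv^{(l)}_{ij}\phi(h^{(l)}_j)+x^{(l-1)}_i+a^{(l)}_i$, $h^{(l)}_i=\sum_jw^{(l)}_{ij}x^{(l-1)}_j+b^{(l)}_i$ with independent Gaussian parameters of mean $0$ and variances $\sigma_v^2/N$, $\sigma_a^2$, $\sigma_w^2/N$, $\sigma_b^2$ respectively for $v,a,w,b$. Its mean-field ($N\to\infty$)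 length quantities $p^{(l)}=\langle(x_1^{(l)})^2\rangle$, $q^{(l)}=\langle(h_1^{(l)})^2\rangle$ are determined by $p^{(0)}$ and, for $l\ge1$, $$q^{(l)}=\sigma_w^2p^{(l-1)}+\sigma_b^2,\qquad p^{(l)}=\sigma_v^2\,\mathrm V\phi(q^{(l)})+\sigma_a^2+p^{(l-1)}.$$ *)

theory Defs
  imports "HOL-Probability.Probability" "HOL-Library.Landau_Symbols"
begin

definition alpha_relu :: "real \<Rightarrow> real \<Rightarrow> real" where
  "alpha_relu \<alpha> x = (if x > 0 then x powr \<alpha> else 0)"

text \<open>The centred normal law parametrised by its variance, whereas \<^const>\<open>normal_density\<close>
  takes the standard deviation. Variance 0 gives the point mass at 0.\<close>

definition centred_gaussian :: "real \<Rightarrow> real measure" where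
  "centred_gaussian q =
     (if q = 0 then return borel 0 else density lborel (normal_density 0 (sqrt q)))"

definition V_transform :: "(real \<Rightarrow> real) \<Rightarrow> real \<Rightarrow> real" where
  "V_transform \<phi> q = (LINT z|centred_gaussian q. (\<phi> z)\<^sup>2)"

definition c_const :: "real \<Rightarrow> real" where
  "c_const \<alpha> = 1 / sqrt pi * 2 powr (\<alpha> - 1) * Gamma (\<alpha> + 1 / 2)"

text \<open>The infinite-width length quantities \<open>p\<close> (of the activations \<open>x\<close>) and \<open>q\<close> (of the
  preactivations \<open>h\<close>) of a full residual network. The first four real parameters are standard
  deviations. The value of \<open>q\<close> at layer 0 has no meaning and is left unconstrained.\<close>

definition frn_lengths ::
    "(real \<Rightarrow> real) \<Rightarrow> real \<Rightarrow> real \<Rightarrow> real \<Rightarrow> real \<Rightarrow> (nat \<Rightarrow> real) \<Rightarrow> (nat \<Rightarrow> real) \<Rightarrow> bool" where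
  "frn_lengths \<phi> \<sigma>\<^sub>v \<sigma>\<^sub>w \<sigma>\<^sub>a \<sigma>\<^sub>b p q \<longleftrightarrow>
     (\<forall>l\<ge>1. q l = \<sigma>\<^sub>w\<^sup>2 * p (l - 1) + \<sigma>\<^sub>b\<^sup>2 \<and>
            p l = \<sigma>\<^sub>v\<^sup>2 * V_transform \<phi> (q l) + \<sigma>\<^sub>a\<^sup>2 + p (l - 1))"

end

theory Submission
  imports Defs "HOL-Real_Asymp.Real_Asymp"
begin

text \<open>Since \<open>V \<psi>\<^sub>\<alpha>\<close> is a pure power, \<open>u\<^sub>l = \<sigma>\<^sub>w\<^sup>2 p\<^sub>l + \<sigma>\<^sub>b\<^sup>2\<close> satisfies an autonomous recurrence
  \<open>u\<^sub>l\<^sub>+\<^sub>1 = u\<^sub>l + K u\<^sub>l\<^sup>\<alpha> + A\<close> with \<open>K, A > 0\<close>. For \<open>\<alpha> = 1\<close> it is affine and is solved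
  explicitly. For \<open>\<alpha> < 1\<close>, as in the ODE \<open>u' = K u\<^sup>\<alpha>\<close>, the power \<open>u\<^sup>1\<^sup>-\<^sup>\<alpha>\<close> linearises the growth:
  \<open>u\<^sub>l\<close> tends to infinity because of \<open>A\<close>, so the increments of \<open>u\<^sub>l\<^sup>1\<^sup>-\<^sup>\<alpha>\<close> converge to \<open>K (1 - \<alpha>)\<close>,
  and a Cesaro mean gives the asymptotics of \<open>u\<^sub>l\<close>.\<close>

text \<open>To first order the difference is
  \<open>(1-a) * u powr (-a) * (K * u powr a + A)\<close>. Its \<open>A\<close> part vanishes
  because \<open>a > 0\<close>, and the second-order term, of size \<open>u powr (a-1)\<close>,
  vanishes because \<open>a < 1\<close>.\<close>

lemma increment_powr_tendsto:
  fixes a K A :: real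
  assumes "0 < a" "a < 1" "0 < K" "0 < A"
  shows "((\<lambda>u. (u + K * u powr a + A) powr (1-a) - u powr (1-a)) \<longlongrightarrow> K * (1-a)) at_top"
  using assms by real_asymp

lemma c_const_1: "c_const 1 = 1 / 2"
proof -
  have "Gamma (1 + 1/2 :: real) = sqrt pi / 2"
    using Gamma_plus1[of "1/2::real"] nonpos_Ints_nonpos[of "1/2::real"]
    by (auto simp: Gamma_one_half_real add.commute)
  then show ?thesis by (simp add: c_const_def)
qed

text \<open>Euler's integral on the open half-line, as the change of variables below requires: the
  endpoint 0 is negligible, and a nonnegative integrand makes integrability absolute.\<close>

lemma absolutely_integrable_Gamma_real:
  assumes "s > (0::real)"
  shows "(\<lambda>t. t powr (s - 1) / exp t) absolutely_integrable_on {0<..}"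
    and "integral {0<..} (\<lambda>t. t powr (s - 1) / exp t) = Gamma s"
proof -
  have *: "((\<lambda>t. t powr (s - 1) / exp t) has_integral Gamma s) {0<..}"
    by (rule iffD1[OF has_integral_spike_set_eq Gamma_integral_real[OF assms]])
       (auto intro: empty_imp_negligible negligible_subset[of "{0}"])
  then show "integral {0<..} (\<lambda>t. t powr (s - 1) / exp t) = Gamma s"
    by (rule integral_unique)
  show "(\<lambda>t. t powr (s - 1) / exp t) absolutely_integrable_on {0<..}"
    using * by (intro nonnegative_absolutely_integrable_1) auto
qed

text \<open>The substitution \<open>t = z\<^sup>2 / (2 * q)\<close> turns the Gaussian moment over
  the positive half-line into the Gamma integral at \<open>s = \<alpha> + 1/2\<close>; the bound on
  \<open>\<alpha>\<close> is exactly \<open>s > 0\<close>.\<close>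

lemma V_transform_alpha_relu:
  assumes \<alpha>: "\<alpha> > - 1 / 2" and q: "q > 0"
  shows "V_transform (alpha_relu \<alpha>) q = c_const \<alpha> * q powr \<alpha>"
proof -
  define s where "s = \<alpha> + 1 / 2"
  define g where "g = (\<lambda>z::real. z\<^sup>2 / (2 * q))"
  define f where "f = (\<lambda>t::real. t powr (s - 1) / exp t)"
  define C where "C = 1 / sqrt pi * 2 powr (\<alpha> - 1) * q powr \<alpha>"
  define G where "G = (\<lambda>z. normal_density 0 (sqrt q) z * z powr (2 * \<alpha>))"
  have s: "s > 0" using \<alpha> by (simp add: s_def)
  have g': "(g has_field_derivative z / q) (at z within {0<..})" for z
    unfolding g_def using q by (auto intro!: derivative_eq_intros simp: field_simps)
  have "inj_on g {0<..}"
    using q by (auto simp: inj_on_def g_def)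
  have "t \<in> g ` {0<..}" if "t > 0" for t
    using that q by (intro image_eqI[of _ _ "sqrt (2 * q * t)"]) (auto simp: g_def)
  then have img: "g ` {0<..} = {0<..}"
    using q by (auto simp: g_def)
  have gam: "(\<lambda>z. \<bar>z / q\<bar> * f (g z)) absolutely_integrable_on {0<..}"
    "integral {0<..} (\<lambda>z. \<bar>z / q\<bar> * f (g z)) = Gamma s"
    using has_absolute_integral_change_of_variables_1'[of "{0<..}" g "\<lambda>z. z / q" f "Gamma s"]
      g' \<open>inj_on g {0<..}\<close> img absolutely_integrable_Gamma_real[OF s]
    unfolding f_def by auto
  \<comment> \<open>The Gaussian integrand is, up to the constant \<open>C\<close>, the pullback of
    the Gamma integrand along \<open>g\<close>. The power of \<open>g z\<close> yields
    \<open>z powr (2 * \<alpha> - 1)\<close>, and the Jacobian \<open>z / q\<close> restores the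
    missing factor \<open>z\<close>.\<close>
  have G: "G z = C * (\<bar>z / q\<bar> * f (g z))" if "z \<in> {0<..}" for z
  proof -
    have z: "z > 0" using that by simp
    have e: "exp (- (z\<^sup>2) / (2 * q)) = 1 / exp (g z)"
      by (simp add: g_def exp_minus field_simps)
    have p: "g z powr (s - 1) = z powr (2 * \<alpha>) / z * ((2 * q) powr (1/2) / (2 * q) powr \<alpha>)"
    proof -
      have "g z powr (s - 1) = (z powr 2) powr (s - 1) / (2 * q) powr (s - 1)"
        using z q by (simp add: g_def powr_divide)
      also have "(z powr 2) powr (s - 1) = z powr (2 * \<alpha> - 1)"
        by (simp add: powr_powr s_def algebra_simps)
      also have "\<dots> = z powr (2 * \<alpha>) / z"
        using z by (simp add: powr_diff)
      also have "(2 * q) powr (s - 1) = (2 * q) powr (\<alpha> - 1/2)"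
        by (simp add: s_def)
      also have "\<dots> = (2 * q) powr \<alpha> / (2 * q) powr (1/2)"
        by (rule powr_diff)
      finally show ?thesis by simp
    qed
    have h: "(2 * q) powr (1/2) = sqrt 2 * sqrt q" "(2 * q) powr \<alpha> = 2 powr \<alpha> * q powr \<alpha>"
      using q by (simp_all add: powr_half_sqrt real_sqrt_mult powr_mult)
    have "G z = z powr (2 * \<alpha>) / (sqrt 2 * sqrt pi * sqrt q) / exp (g z)"
      using q e by (simp add: G_def normal_density_def real_sqrt_mult)
    also have "\<dots> = C * (\<bar>z / q\<bar> * f (g z))"
    proof -
      have "sqrt 2 * (sqrt q * (sqrt 2 * sqrt q)) = (sqrt 2 * sqrt 2) * (sqrt q * sqrt q)"
        by (simp only: mult_ac)
      also have "\<dots> = 2 * q" using q by simp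
      finally have eq: "sqrt 2 * (sqrt q * (sqrt 2 * sqrt q)) = 2 * q" .
      show ?thesis
        unfolding f_def p h C_def using z q by (simp add: powr_diff divide_simps) (simp only: eq)
    qed
    finally show ?thesis .
  qed
  have int: "(\<lambda>z. C * (\<bar>z / q\<bar> * f (g z))) absolutely_integrable_on {0<..}"
    using set_integrable_mult_right[OF gam(1)] by blast
  have square: "(z powr \<alpha>)\<^sup>2 = z powr (2 * \<alpha>)" for z
    by (simp add: power2_eq_square flip: powr_add)
  have "V_transform (alpha_relu \<alpha>) q
      = (LINT z|lborel. normal_density 0 (sqrt q) z * (alpha_relu \<alpha> z)\<^sup>2)"
    unfolding V_transform_def centred_gaussian_def using q
    by (simp add: integral_density alpha_relu_def)
  also have "\<dots> = (LINT z:{0<..}|lborel. G z)"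
    unfolding set_lebesgue_integral_def
    by (intro Bochner_Integration.integral_cong)
       (auto simp: G_def alpha_relu_def square)
  \<comment> \<open>Absolute integrability refers to the completed measure, so the integral is moved
    there first.\<close>
  also have "\<dots> = (LINT z:{0<..}|lebesgue. G z)"
    unfolding set_lebesgue_integral_def
    by (subst integral_completion) (auto simp: G_def)
  also have "\<dots> = (LINT z:{0<..}|lebesgue. C * (\<bar>z / q\<bar> * f (g z)))"
    by (rule set_lebesgue_integral_cong) (simp_all add: G)
  also have "\<dots> = integral {0<..} (\<lambda>z. C * (\<bar>z / q\<bar> * f (g z)))"
    by (rule set_lebesgue_integral_eq_integral(2)[OF int])
  also have "\<dots> = C * Gamma s"
    by (simp only: integral_mult_right gam(2))
  finally show ?thesis
    by (simp add: C_def c_const_def s_def)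
qed

text \<open>A Cesaro argument: from some \<open>N\<close> on, \<open>v l - d * l\<close> drifts by
  at most \<open>e / 2\<close> per step, and the fixed discrepancy at \<open>N\<close>, divided by
  \<open>l\<close>, eventually uses less than the other \<open>e / 2\<close>.\<close>

lemma divide_nat_tendsto_of_increments:
  fixes v :: "nat \<Rightarrow> real"
  assumes "(\<lambda>l. v (Suc l) - v l) \<longlonglongrightarrow> d"
  shows "(\<lambda>l. v l / real l) \<longlonglongrightarrow> d"
proof (rule LIMSEQ_I)
  fix e :: real assume "e > 0"
  obtain N where N: "\<bar>v (Suc l) - v l - d\<bar> < e / 2" if "l \<ge> N" for l
    using LIMSEQ_D[OF assms, of "e / 2"] \<open>e > 0\<close> by auto
  have bound: "\<bar>(v l - d * l) - (v N - d * N)\<bar> \<le> e / 2 * (real l - real N)" if "l \<ge> N" for l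
    using that
  proof (induction l rule: dec_induct)
    case (step l)
    have "\<bar>(v (Suc l) - d * Suc l) - (v N - d * N)\<bar>
        = \<bar>(v (Suc l) - v l - d) + ((v l - d * l) - (v N - d * N))\<bar>"
      by (simp add: algebra_simps)
    also have "\<dots> \<le> \<bar>v (Suc l) - v l - d\<bar> + \<bar>(v l - d * l) - (v N - d * N)\<bar>"
      by (rule abs_triangle_ineq)
    also have "\<dots> \<le> e / 2 + e / 2 * (real l - real N)"
      using step by (intro add_mono less_imp_le[OF N]) auto
    also have "\<dots> = e / 2 * (real (Suc l) - real N)"
      by (simp add: field_simps)
    finally show ?case .
  qed simp
  have "(\<lambda>l. \<bar>v N - d * N\<bar> / real l) \<longlonglongrightarrow> 0"
    by real_asymp
  then have "\<forall>\<^sub>F l in sequentially. \<bar>v N - d * N\<bar> / real l < e / 2"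
    using \<open>e > 0\<close> by (intro order_tendstoD) auto
  then have "\<forall>\<^sub>F l in sequentially. norm (v l / real l - d) < e"
    using eventually_gt_at_top[of 0] eventually_ge_at_top[of N]
  proof eventually_elim
    case (elim l)
    have "\<bar>v l - d * l\<bar> \<le> \<bar>v N - d * N\<bar> + \<bar>(v l - d * l) - (v N - d * N)\<bar>"
      by linarith
    also have "\<dots> \<le> \<bar>v N - d * N\<bar> + e / 2 * (real l - real N)"
      using bound[OF elim(3)] by simp
    also have "\<dots> \<le> \<bar>v N - d * N\<bar> + e / 2 * l"
      using \<open>e > 0\<close> by simp
    also have "\<dots> < e * l"
      using elim(1,2) by (simp add: field_simps)
    finally have "\<bar>v l - d * l\<bar> / l < e"
      using elim(2) by (simp add: field_simps)
    moreover have "v l / l - d = (v l - d * l) / l"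
      using elim(2) by (simp add: field_simps)
    ultimately show ?case
      by simp
  qed
  then show "\<exists>no. \<forall>l\<ge>no. norm (v l / real l - d) < e"
    by (simp add: eventually_sequentially)
qed

lemma powr_recurrence_asymptotics:
  fixes u :: "nat \<Rightarrow> real"
  assumes a: "0 < a" "a < 1" and "0 < K" "0 < A" and "u 0 \<ge> 0"
    and rec: "\<And>l. u (Suc l) = u l + K * u l powr a + A"
  shows "(\<lambda>l. u l / real l powr (1 / (1 - a))) \<longlonglongrightarrow> (K * (1 - a)) powr (1 / (1 - a))"
proof -
  \<comment> \<open>Dropping the power term leaves a crude linear bound, enough for both divergence
    and nonnegativity.\<close>
  have lower: "u l \<ge> A * real l" for l
  proof (induction l)
    case (Suc l)
    have "0 \<le> K * u l powr a" using \<open>0 < K\<close> by simp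
    then show ?case using Suc by (simp add: rec algebra_simps)
  qed (use assms in simp)
  have "filterlim (\<lambda>l. A * real l) at_top sequentially"
    using \<open>0 < A\<close> by real_asymp
  then have "filterlim u at_top sequentially"
    by (rule filterlim_at_top_mono) (simp add: lower)
  with increment_powr_tendsto[OF a \<open>0 < K\<close> \<open>0 < A\<close>]
  have "(\<lambda>l. u (Suc l) powr (1 - a) - u l powr (1 - a)) \<longlonglongrightarrow> K * (1 - a)"
    unfolding rec by (rule filterlim_compose)
  then have "(\<lambda>l. u l powr (1 - a) / real l) \<longlonglongrightarrow> K * (1 - a)"
    by (rule divide_nat_tendsto_of_increments)
  then have "(\<lambda>l. (u l powr (1 - a) / real l) powr (1 / (1 - a)))
      \<longlonglongrightarrow> (K * (1 - a)) powr (1 / (1 - a))"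
    using a \<open>0 < K\<close> by (intro tendsto_powr tendsto_const) auto
  \<comment> \<open>Nonnegativity lets the outer power undo the inner one, as
    \<open>x powr 1 = x\<close> needs \<open>x \<ge> 0\<close>.\<close>
  moreover have "u l \<ge> 0" for l
    using lower[of l] \<open>0 < A\<close> by (meson mult_nonneg_nonneg of_nat_0_le_iff less_imp_le order_trans)
  then have "(u l powr (1 - a) / real l) powr (1 / (1 - a)) = u l / real l powr (1 / (1 - a))" for l
    using a by (simp add: powr_divide powr_powr)
  ultimately show ?thesis by simp
qed

lemma bigthetaI_tendsto_nonzero:
  fixes f g :: "'a \<Rightarrow> real"
  assumes "((\<lambda>x. f x / g x) \<longlongrightarrow> c) F" "c \<noteq> 0" "eventually (\<lambda>x. g x \<noteq> 0) F"
  shows "f \<in> \<Theta>[F](g)"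
  using assms by (intro bigthetaI bigoI_tendsto bigomegaI_tendsto)

theorem theoremB16:
  fixes \<alpha> \<sigma>\<^sub>v \<sigma>\<^sub>w \<sigma>\<^sub>a \<sigma>\<^sub>b :: real and p q :: "nat \<Rightarrow> real"
  assumes "\<sigma>\<^sub>v > 0" "\<sigma>\<^sub>w > 0" "\<sigma>\<^sub>a > 0" "\<sigma>\<^sub>b > 0"
    and "p 0 \<ge> 0"
    and "frn_lengths (alpha_relu \<alpha>) \<sigma>\<^sub>v \<sigma>\<^sub>w \<sigma>\<^sub>a \<sigma>\<^sub>b p q"
  shows "(\<alpha> = 1 \<longrightarrow> p \<in> \<Theta>(\<lambda>l. (1 + \<sigma>\<^sub>v\<^sup>2 * \<sigma>\<^sub>w\<^sup>2 / 2) ^ l)) \<and>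
         (0 < \<alpha> \<and> \<alpha> < 1 \<longrightarrow>
            p \<in> \<Theta>(\<lambda>l. real l powr (1 / (1 - \<alpha>))) \<and>
            (\<lambda>l. p l / real l powr (1 / (1 - \<alpha>)))
              \<longlonglongrightarrow> (\<sigma>\<^sub>v\<^sup>2 * \<sigma>\<^sub>w powr (2 * \<alpha>) * c_const \<alpha> * (1 - \<alpha>)) powr (1 / (1 - \<alpha>)))"
proof -
  \<comment> \<open>This is \<open>q (Suc l)\<close>; the shift avoids the unconstrained value
    \<open>q 0\<close>.\<close>
  define u where "u l = \<sigma>\<^sub>w\<^sup>2 * p l + \<sigma>\<^sub>b\<^sup>2" for l
  note pos = assms(1-5)
  have rec_V: "p (Suc l) = \<sigma>\<^sub>v\<^sup>2 * V_transform (alpha_relu \<alpha>) (u l) + \<sigma>\<^sub>a\<^sup>2 + p l" for l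
    using assms(6)[unfolded frn_lengths_def, rule_format, of "Suc l"] by (simp add: u_def)
  \<comment> \<open>Positivity of \<open>u\<close> has to precede the closed form of the
    V-transform, which needs a positive variance.\<close>
  have "V_transform (alpha_relu \<alpha>) x \<ge> 0" for x
    unfolding V_transform_def by simp
  then have p_nonneg: "p l \<ge> 0" for l
    using pos by (induction l) (simp_all add: rec_V)
  then have u_pos: "u l > 0" for l
    using pos by (simp add: u_def add_nonneg_pos)
  have rec: "p (Suc l) = p l + \<sigma>\<^sub>v\<^sup>2 * c_const \<alpha> * u l powr \<alpha> + \<sigma>\<^sub>a\<^sup>2" if "0 < \<alpha>" for l
    using that u_pos[of l] by (simp add: rec_V V_transform_alpha_relu)
  have "p \<in> \<Theta>(\<lambda>l. (1 + \<sigma>\<^sub>v\<^sup>2 * \<sigma>\<^sub>w\<^sup>2 / 2) ^ l)" if "\<alpha> = 1"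
  proof -
    define k where "k = \<sigma>\<^sub>v\<^sup>2 * \<sigma>\<^sub>w\<^sup>2 / 2"
    \<comment> \<open>Chosen so that \<open>-D\<close> is the fixed point of the affine recurrence,
      which makes \<open>p l + D\<close> geometric with ratio \<open>1 + k\<close>.\<close>
    define D where "D = (\<sigma>\<^sub>v\<^sup>2 * \<sigma>\<^sub>b\<^sup>2 / 2 + \<sigma>\<^sub>a\<^sup>2) / k"
    have k: "k > 0" and D: "D > 0"
      using pos by (simp_all add: k_def D_def add_pos_pos)
    have rec1: "p (Suc l) = (1 + k) * p l + k * D" for l
      using rec[of l] u_pos[of l] k that
      by (simp add: D_def c_const_1) (simp add: u_def k_def algebra_simps)
    have closed: "p l = (p 0 + D) * (1 + k) ^ l - D" for l
      proof (induction l)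
      case (Suc l)
      show ?case unfolding rec1 Suc by (simp add: algebra_simps)
    qed simp
    \<comment> \<open>The limit \<open>p 0 + D\<close> carries the initial condition and is positive
      even for \<open>p 0 = 0\<close>.\<close>
    have "(\<lambda>l. p 0 + D - D * (1 / (1 + k)) ^ l) \<longlonglongrightarrow> p 0 + D - D * 0"
      using k by (intro tendsto_intros LIMSEQ_realpow_zero) auto
    moreover have "p l / (1 + k) ^ l = p 0 + D - D * (1 / (1 + k)) ^ l" for l
      using k by (subst closed) (simp add: field_simps)
    ultimately have "(\<lambda>l. p l / (1 + k) ^ l) \<longlonglongrightarrow> p 0 + D"
      by simp
    then have "p \<in> \<Theta>(\<lambda>l. (1 + k) ^ l)"
      using k D pos by (intro bigthetaI_tendsto_nonzero) auto
    then show ?thesis by (simp add: k_def)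
  qed
  moreover have "p \<in> \<Theta>(\<lambda>l. real l powr (1 / (1 - \<alpha>))) \<and>
      (\<lambda>l. p l / real l powr (1 / (1 - \<alpha>)))
        \<longlonglongrightarrow> (\<sigma>\<^sub>v\<^sup>2 * \<sigma>\<^sub>w powr (2 * \<alpha>) * c_const \<alpha> * (1 - \<alpha>)) powr (1 / (1 - \<alpha>))"
    if \<alpha>: "0 < \<alpha>" "\<alpha> < 1"
  proof -
    define r where "r = 1 / (1 - \<alpha>)"
    define L where "L = \<sigma>\<^sub>v\<^sup>2 * c_const \<alpha> * (1 - \<alpha>)"
    have r: "r > 0" and r_eq: "r = 1 + \<alpha> * r"
      using \<alpha> by (simp_all add: r_def field_simps)
    have c: "c_const \<alpha> > 0"
      using \<alpha> by (simp add: c_const_def Gamma_real_pos)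
    have L: "L > 0"
      using pos \<alpha> c by (simp add: L_def)
    \<comment> \<open>Scaling the recurrence of \<open>p\<close> by
      \<open>\<sigma>\<^sub>w\<^sup>2\<close> gives that of \<open>u\<close>, with
      \<open>A = \<sigma>\<^sub>w\<^sup>2 * \<sigma>\<^sub>a\<^sup>2\<close>.\<close>
    have "(\<lambda>l. u l / real l powr (1 / (1 - \<alpha>)))
        \<longlonglongrightarrow> (\<sigma>\<^sub>w\<^sup>2 * \<sigma>\<^sub>v\<^sup>2 * c_const \<alpha> * (1 - \<alpha>)) powr (1 / (1 - \<alpha>))"
    proof (rule powr_recurrence_asymptotics)
      show "u (Suc l) = u l + \<sigma>\<^sub>w\<^sup>2 * \<sigma>\<^sub>v\<^sup>2 * c_const \<alpha> * u l powr \<alpha> + \<sigma>\<^sub>w\<^sup>2 * \<sigma>\<^sub>a\<^sup>2" for l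
        unfolding u_def[of "Suc l"] rec[OF \<alpha>(1)] by (simp add: u_def[of l] algebra_simps)
    qed (use \<alpha> pos c u_pos[of 0] in auto)
    then have u_lim: "(\<lambda>l. u l / real l powr r) \<longlonglongrightarrow> (\<sigma>\<^sub>w\<^sup>2 * L) powr r"
      by (simp add: r_def L_def mult.assoc)
    \<comment> \<open>Back from \<open>u\<close> to \<open>p\<close> by inverting the affine map;
      the bias term washes out since \<open>r > 0\<close>.\<close>
    have "(\<lambda>l. (u l / real l powr r - \<sigma>\<^sub>b\<^sup>2 / real l powr r) / \<sigma>\<^sub>w\<^sup>2)
        \<longlonglongrightarrow> ((\<sigma>\<^sub>w\<^sup>2 * L) powr r - 0) / \<sigma>\<^sub>w\<^sup>2"
    proof (intro tendsto_intros u_lim)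
      show "(\<lambda>l. \<sigma>\<^sub>b\<^sup>2 / real l powr r) \<longlonglongrightarrow> 0"
        using r by real_asymp
    qed (use pos in auto)
    also have "(\<lambda>l. (u l / real l powr r - \<sigma>\<^sub>b\<^sup>2 / real l powr r) / \<sigma>\<^sub>w\<^sup>2) = (\<lambda>l. p l / real l powr r)"
      using pos by (simp add: u_def fun_eq_iff add_divide_distrib)
    \<comment> \<open>Since \<open>r = 1 + \<alpha> * r\<close>, the division cancels one factor
      \<open>\<sigma>\<^sub>w\<^sup>2\<close> and leaves the exponent \<open>\<alpha> * r\<close>,
      whence \<open>\<sigma>\<^sub>w powr (2 * \<alpha>)\<close>.\<close>
    also have "((\<sigma>\<^sub>w\<^sup>2 * L) powr r - 0) / \<sigma>\<^sub>w\<^sup>2 = (\<sigma>\<^sub>w powr (2 * \<alpha>) * L) powr r"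
    proof -
      have "(\<sigma>\<^sub>w\<^sup>2) powr r = \<sigma>\<^sub>w\<^sup>2 * (\<sigma>\<^sub>w\<^sup>2) powr (\<alpha> * r)"
        using pos by (subst r_eq) (simp add: powr_add)
      also have "(\<sigma>\<^sub>w\<^sup>2) powr (\<alpha> * r) = (\<sigma>\<^sub>w powr (2 * \<alpha>)) powr r"
        using pos by (simp add: powr_powr mult.assoc flip: powr_numeral)
      finally show ?thesis
        using pos L by (simp add: powr_mult)
    qed
    finally have lim: "(\<lambda>l. p l / real l powr r) \<longlonglongrightarrow> (\<sigma>\<^sub>w powr (2 * \<alpha>) * L) powr r" .
    moreover have "p \<in> \<Theta>(\<lambda>l. real l powr r)"
      using lim
    proof (rule bigthetaI_tendsto_nonzero)
      show "(\<sigma>\<^sub>w powr (2 * \<alpha>) * L) powr r \<noteq> 0"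
        using pos L by simp
      show "\<forall>\<^sub>F l in sequentially. real l powr r \<noteq> 0"
        using eventually_gt_at_top[of 0] by eventually_elim simp
    qed
    ultimately show ?thesis
      by (simp add: r_def L_def mult_ac)
  qed
  ultimately show ?thesis by blast
qed

end
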